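(* The contravariant functor $\operatorname{Hom}(-)\colon\mathbf{Ring}\to\mathbf{Set}$, $R\mapsto\operatorname{Hom}(R)$, is not representable; that is, there is no ring $A$ such that $\operatorname{Hom}(-)$ is naturally isomorphic to the contravariant functor $\operatorname{Hom}_{\mathbf{Ring}}(-,A)\colon\mathbf{Ring}\to\mathbf{Set}$.
   Context: All rings are associative with identity $1\neq 0$ and ring morphisms send $1$ to $1$; $\mathbf{Ring}$ is the category of all such rings and $\operatorname{Hom}_{\mathbf{Ring}}(R,A)$ is the set of ring morphisms $R\to A$. $U(S)$ denotes the group of two-sided invertible elements of a ring $S$. For a ring $R$, $\operatorname{Hom}(R)$ (with one argument) denotes the set of all pairs $(\ker(\varphi),\varphi^{-1}(U(S)))$ where $\varphi\colon R\to S$ is a ring morphism into an arbitrary ring $S$. For a ring morphism $f\colon R\to R'$, the map $\operatorname{Hom}(f)\colon\operatorname{Hom}(R')\to\operatorname{Hom}(R)$ is $(\mathfrak a',M')\mapsto(f^{-1}(\mathfrak a'),f^{-1}(M'))$. *)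

theory Defs
  imports "HOL-Algebra.Algebra"
begin

section \<open>The category of rings\<close>

text \<open>
  HOL has no collection of all rings across all types. The category \<open>Ring\<close> is
  therefore taken relative to a universe type \<open>'u\<close>: its objects are the rings
  (associative, not necessarily commutative, with \<open>1 \<noteq> 0\<close>) whose carrier is a subset of \<open>'u\<close>.
  Statements about \<open>Ring\<close> are to be read for every infinite type \<open>'u\<close>.
\<close>

definition Ring_obj :: "'u ring set" where
  "Ring_obj = {R. ring R \<and> \<one>\<^bsub>R\<^esub> \<noteq> \<zero>\<^bsub>R\<^esub>}"

text \<open>
  Elements of \<open>ring_hom R S\<close> are total functions whose values outside the
  carrier are arbitrary. A morphism \<open>R \<rightarrow> S\<close> of the category is represented by the unique such
  function that is \<open>undefined\<close> outside the carrier.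
\<close>

definition Ring_hom :: "'u ring \<Rightarrow> 'u ring \<Rightarrow> ('u \<Rightarrow> 'u) set" where
  "Ring_hom R S = ring_hom R S \<inter> extensional (carrier R)"


section \<open>Contravariant functors from rings to sets\<close>

text \<open>
  A contravariant functor is given by its object part \<open>F\<close> and its morphism part \<open>Fm\<close>, where
  \<open>Fm R R' f\<close> is the map \<open>F R' \<rightarrow> F R\<close> induced by \<open>f: R \<rightarrow> R'\<close>. Identities and composites of
  morphisms are \<open>restrict id\<close> and \<open>compose\<close>, so that they stay extensional.
\<close>

definition contravariant_functor ::
  "('u ring \<Rightarrow> 'x set) \<Rightarrow> ('u ring \<Rightarrow> 'u ring \<Rightarrow> ('u \<Rightarrow> 'u) \<Rightarrow> 'x \<Rightarrow> 'x) \<Rightarrow> bool" where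
  "contravariant_functor F Fm \<longleftrightarrow>
     (\<forall>R\<in>Ring_obj. \<forall>R'\<in>Ring_obj. \<forall>f\<in>Ring_hom R R'. Fm R R' f \<in> F R' \<rightarrow> F R) \<and>
     (\<forall>R\<in>Ring_obj. \<forall>x\<in>F R. Fm R R (restrict id (carrier R)) x = x) \<and>
     (\<forall>R\<in>Ring_obj. \<forall>R'\<in>Ring_obj. \<forall>R''\<in>Ring_obj. \<forall>f\<in>Ring_hom R R'. \<forall>g\<in>Ring_hom R' R''.
        \<forall>x\<in>F R''. Fm R R'' (compose (carrier R) g f) x = Fm R R' f (Fm R' R'' g x))"

definition naturally_isomorphic ::
  "('u ring \<Rightarrow> 'x set) \<Rightarrow> ('u ring \<Rightarrow> 'u ring \<Rightarrow> ('u \<Rightarrow> 'u) \<Rightarrow> 'x \<Rightarrow> 'x) \<Rightarrow>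
   ('u ring \<Rightarrow> 'y set) \<Rightarrow> ('u ring \<Rightarrow> 'u ring \<Rightarrow> ('u \<Rightarrow> 'u) \<Rightarrow> 'y \<Rightarrow> 'y) \<Rightarrow> bool" where
  "naturally_isomorphic F Fm G Gm \<longleftrightarrow>
     (\<exists>\<eta>. (\<forall>R\<in>Ring_obj. bij_betw (\<eta> R) (F R) (G R)) \<and>
          (\<forall>R\<in>Ring_obj. \<forall>R'\<in>Ring_obj. \<forall>f\<in>Ring_hom R R'. \<forall>x\<in>F R'.
             \<eta> R (Fm R R' f x) = Gm R R' f (\<eta> R' x)))"

definition repr_obj :: "'u ring \<Rightarrow> 'u ring \<Rightarrow> ('u \<Rightarrow> 'u) set" where
  "repr_obj A R = Ring_hom R A"

definition repr_map ::
  "'u ring \<Rightarrow> 'u ring \<Rightarrow> 'u ring \<Rightarrow> ('u \<Rightarrow> 'u) \<Rightarrow> ('u \<Rightarrow> 'u) \<Rightarrow> ('u \<Rightarrow> 'u)" where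
  "repr_map A R R' f = (\<lambda>g. compose (carrier R) g f)"

definition representable ::
  "('u ring \<Rightarrow> 'x set) \<Rightarrow> ('u ring \<Rightarrow> 'u ring \<Rightarrow> ('u \<Rightarrow> 'u) \<Rightarrow> 'x \<Rightarrow> 'x) \<Rightarrow> bool" where
  "representable F Fm \<longleftrightarrow>
     (\<exists>A\<in>Ring_obj. naturally_isomorphic F Fm (repr_obj A) (repr_map A))"


section \<open>The functor Hom(-)\<close>

definition ker_units_pair ::
  "('a, 'm) ring_scheme \<Rightarrow> ('b, 'n) ring_scheme \<Rightarrow> ('a \<Rightarrow> 'b) \<Rightarrow> 'a set \<times> 'a set" where
  "ker_units_pair R S \<phi> = (a_kernel R S \<phi>, {x \<in> carrier R. \<phi> x \<in> Units S})"

text \<open>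
  Here the codomain \<open>S\<close> ranges over the objects of the category. By
  \<open>ker_units_pair_in_Hom_obj\<close> below, for infinite \<open>'u\<close> codomains over arbitrary other types yield
  no further pairs, so this is the set of pairs for arbitrary rings \<open>S\<close>.
\<close>

definition Hom_obj :: "'u ring \<Rightarrow> ('u set \<times> 'u set) set" where
  "Hom_obj R = {ker_units_pair R S \<phi> | S \<phi>. S \<in> Ring_obj \<and> \<phi> \<in> Ring_hom R S}"

definition Hom_map ::
  "'u ring \<Rightarrow> 'u ring \<Rightarrow> ('u \<Rightarrow> 'u) \<Rightarrow> 'u set \<times> 'u set \<Rightarrow> 'u set \<times> 'u set" where
  "Hom_map R R' f = (\<lambda>(\<aa>, M). ({x \<in> carrier R. f x \<in> \<aa>}, {x \<in> carrier R. f x \<in> M}))"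


section \<open>Functoriality\<close>

lemma Ring_hom_closed: "f \<in> Ring_hom R S \<Longrightarrow> x \<in> carrier R \<Longrightarrow> f x \<in> carrier S"
  by (auto simp: Ring_hom_def ring_hom_def)

lemma Ring_hom_compose:
  assumes "ring R" "f \<in> Ring_hom R S" "g \<in> Ring_hom S T"
  shows "compose (carrier R) g f \<in> Ring_hom R T"
proof -
  interpret ring R by fact
  show ?thesis using assms(2,3)
    by (auto simp: Ring_hom_def ring_hom_def compose_def Pi_iff)
qed

lemma repr_functor:
  assumes "A \<in> Ring_obj"
  shows "contravariant_functor (repr_obj A) (repr_map A)"
proof -
  have "compose (carrier R) g f \<in> Ring_hom R A"
    if "R \<in> Ring_obj" "f \<in> Ring_hom R R'" "g \<in> Ring_hom R' A" for R R' f g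
    using Ring_hom_compose that by (auto simp: Ring_obj_def)
  moreover have "compose (carrier R) g (restrict id (carrier R)) = g" if "g \<in> Ring_hom R A" for R g
    using that by (auto simp: Ring_hom_def compose_def extensional_def)
  moreover have "compose (carrier R) h (compose (carrier R) g f) =
      compose (carrier R) (compose (carrier R') h g) f" if "f \<in> Ring_hom R R'" for R R' f g h
    using Ring_hom_closed[OF that] by (auto simp: compose_def)
  ultimately show ?thesis
    unfolding contravariant_functor_def repr_obj_def repr_map_def by blast
qed

lemma Hom_functor: "contravariant_functor Hom_obj Hom_map"
proof -
  have "Hom_map R R' f p \<in> Hom_obj R"
    if "R \<in> Ring_obj" "R' \<in> Ring_obj" "f \<in> Ring_hom R R'" "p \<in> Hom_obj R'" for R R' f p
  proof -
    obtain S \<phi> where S: "S \<in> Ring_obj" "\<phi> \<in> Ring_hom R' S" and p: "p = ker_units_pair R' S \<phi>"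
      using \<open>p \<in> Hom_obj R'\<close> unfolding Hom_obj_def by auto
    have "Hom_map R R' f p = ker_units_pair R S (compose (carrier R) \<phi> f)"
      using Ring_hom_closed[OF that(3)]
      by (auto simp: p Hom_map_def ker_units_pair_def a_kernel_def' compose_def)
    moreover have "compose (carrier R) \<phi> f \<in> Ring_hom R S"
      using Ring_hom_compose that S by (auto simp: Ring_obj_def)
    ultimately show ?thesis using S(1) unfolding Hom_obj_def by blast
  qed
  moreover have "Hom_map R R (restrict id (carrier R)) p = p" if "p \<in> Hom_obj R" for R and p
    using that by (auto simp: Hom_obj_def Hom_map_def ker_units_pair_def a_kernel_def')
  moreover have "Hom_map R R'' (compose (carrier R) g f) p = Hom_map R R' f (Hom_map R' R'' g p)"
    if "f \<in> Ring_hom R R'" for R R' R'' f g p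
    using Ring_hom_closed[OF that] by (auto simp: Hom_map_def compose_def split: prod.splits)
  ultimately show ?thesis
    unfolding contravariant_functor_def by blast
qed


section \<open>Independence of the universe of codomains\<close>

text \<open>
  The ring generated by the image of \<open>R\<close> and the inverses of the units in that image is large
  enough to compute the pair of \<open>\<phi>\<close>, and it embeds into every infinite type containing \<open>R\<close>.
\<close>

lemma card_generate_ring:
  assumes inf: "infinite (UNIV :: 'u set)" and H: "|H| \<le>o |UNIV :: 'u set|"
  shows "|generate_ring S H| \<le>o |UNIV :: 'u set|"
proof -
  let ?U = "UNIV :: 'u set"
  define step where "step Z = Z \<union> a_inv S ` Z
      \<union> (\<lambda>(x, y). x \<oplus>\<^bsub>S\<^esub> y) ` (Z \<times> Z)
      \<union> (\<lambda>(x, y). x \<otimes>\<^bsub>S\<^esub> y) ` (Z \<times> Z)" for Z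
  define T where "T n = (step ^^ n) (insert \<one>\<^bsub>S\<^esub> H)" for n
  have image: "|f ` Z| \<le>o |?U|" if "|Z| \<le>o |?U|" for f :: "'c \<Rightarrow> 'd" and Z
    using card_of_image that ordLeq_transitive by blast
  have un: "|Z \<union> Y| \<le>o |?U|" if "|Z| \<le>o |?U|" "|Y| \<le>o |?U|" for Z Y :: "'c set"
    using card_of_Un_ordLeq_infinite_Field[of "|?U|" Z Y] that inf
    by (simp add: Field_card_of card_of_Card_order)
  have times: "|Z \<times> Z| \<le>o |?U|" if "|Z| \<le>o |?U|" for Z :: "'c set"
    using card_of_Times_ordLeq_infinite_Field[of "|?U|" Z Z] that inf
    by (simp add: Field_card_of card_of_Card_order)
  have "|{\<one>\<^bsub>S\<^esub>}| \<le>o |?U|"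
    by (rule card_of_singl_ordLeq) simp
  then have base: "|insert \<one>\<^bsub>S\<^esub> H| \<le>o |?U|"
    using un[OF _ H, of "{\<one>\<^bsub>S\<^esub>}"] by simp
  have T_le: "|T n| \<le>o |?U|" for n
  proof (induction n)
    case 0
    then show ?case using base by (simp add: T_def)
  next
    case (Suc n)
    then show ?case
      unfolding T_def by (auto simp: step_def intro!: un image times)
  qed
  have "|UNIV :: nat set| \<le>o |?U|"
    using inf infinite_iff_card_of_nat by blast
  then have union: "|\<Union>n. T n| \<le>o |?U|"
    using card_of_UNION_ordLeq_infinite[OF inf] T_le by blast
  have T_Suc: "T (Suc n) = step (T n)" for n
    by (simp add: T_def)
  have mono: "T m \<subseteq> T n" if "m \<le> n" for m n
    using that by (rule lift_Suc_mono_le[rotated]) (auto simp: T_Suc step_def)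
  have common: "\<exists>n. x \<in> T n \<and> y \<in> T n" if "x \<in> T i" "y \<in> T j" for x y i j
    using that mono[of i "max i j"] mono[of j "max i j"] by auto
  have "generate_ring S H \<subseteq> (\<Union>n. T n)"
  proof
    fix x assume "x \<in> generate_ring S H"
    then show "x \<in> (\<Union>n. T n)"
    proof induction
      case one
      have "\<one>\<^bsub>S\<^esub> \<in> T 0" by (simp add: T_def)
      then show ?case by blast
    next
      case (incl h)
      then have "h \<in> T 0" by (simp add: T_def)
      then show ?case by blast
    next
      case (a_inv h)
      then obtain n where "h \<in> T n" by blast
      then have "\<ominus>\<^bsub>S\<^esub> h \<in> T (Suc n)" by (auto simp: T_Suc step_def)
      then show ?case by blast
    next
      case (eng_add h1 h2)
      then obtain n where "h1 \<in> T n" "h2 \<in> T n" using common by blast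
      then have "h1 \<oplus>\<^bsub>S\<^esub> h2 \<in> T (Suc n)" by (auto simp: T_Suc step_def)
      then show ?case by blast
    next
      case (eng_mult h1 h2)
      then obtain n where "h1 \<in> T n" "h2 \<in> T n" using common by blast
      then have "h1 \<otimes>\<^bsub>S\<^esub> h2 \<in> T (Suc n)" by (auto simp: T_Suc step_def)
      then show ?case by blast
    qed
  qed
  then show ?thesis
    using union card_of_mono1 ordLeq_transitive by blast
qed

lemma ker_units_pair_in_Hom_obj:
  fixes R :: "'u ring" and S :: "('b, 'n) ring_scheme"
  assumes inf: "infinite (UNIV :: 'u set)"
    and "ring S" and nz: "\<one>\<^bsub>S\<^esub> \<noteq> \<zero>\<^bsub>S\<^esub>" and \<phi>: "\<phi> \<in> ring_hom R S" and "ring R"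
  shows "ker_units_pair R S \<phi> \<in> Hom_obj R"
proof -
  interpret R: ring R by fact
  interpret S: ring S by fact
  let ?U = "UNIV :: 'u set"
  let ?I = "\<phi> ` carrier R"
  define H where "H = ?I \<union> (\<lambda>s. inv\<^bsub>S\<^esub> s) ` (?I \<inter> Units S)"
  define G where "G = S\<lparr>carrier := generate_ring S H\<rparr>"
  have I: "?I \<subseteq> carrier S"
    using \<phi> by (auto simp: ring_hom_def)
  have H: "H \<subseteq> carrier S"
    using I by (auto simp: H_def)
  interpret G: ring G
    unfolding G_def by (rule S.generate_ring_is_ring[OF H])
  have le1: "|?I| \<le>o |?U|"
    using card_of_image card_of_mono1[OF subset_UNIV] ordLeq_transitive by blast
  then have "|?I \<inter> Units S| \<le>o |?U|"
    using card_of_mono1[OF Int_lower1] ordLeq_transitive by blast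
  then have le2: "|(\<lambda>s. inv\<^bsub>S\<^esub> s) ` (?I \<inter> Units S)| \<le>o |?U|"
    using card_of_image ordLeq_transitive by blast
  have "|H| \<le>o |?U|"
    unfolding H_def using card_of_Un_ordLeq_infinite_Field[of "|?U|"] le1 le2 inf
    by (simp add: Field_card_of card_of_Card_order)
  then have "|carrier G| \<le>o |?U|"
    unfolding G_def using card_generate_ring[OF inf] by simp
  then obtain e :: "'b \<Rightarrow> 'u" where e: "inj_on e (carrier G)"
    using card_of_ordLeq[of "carrier G" ?U] by blast
  define S' where "S' = image_ring e G"
  define \<psi> where "\<psi> = restrict (e \<circ> \<phi>) (carrier R)"
  have iso: "e \<in> ring_iso G S'"
    unfolding S'_def using inj_imp_image_ring_iso[OF e] .
  then have hom: "e \<in> ring_hom G S'" and bij: "bij_betw e (carrier G) (carrier S')"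
    by (auto simp: ring_iso_def)
  interpret S': ring S'
    unfolding S'_def by (rule G.inj_imp_image_ring_is_ring[OF e])
  have zero: "e \<zero>\<^bsub>G\<^esub> = \<zero>\<^bsub>S'\<^esub>" and one: "e \<one>\<^bsub>G\<^esub> = \<one>\<^bsub>S'\<^esub>"
    by (simp_all add: S'_def image_ring_zero image_ring_one)
  have inj: "e x = e y \<longleftrightarrow> x = y" if "x \<in> carrier G" "y \<in> carrier G" for x y
    using e that by (auto dest: inj_onD)
  have HG: "x \<in> carrier G" if "x \<in> H" for x
    using that by (simp add: G_def generate_ring.incl)
  have \<phi>G: "\<phi> x \<in> carrier G" if "x \<in> carrier R" for x
    using HG that by (auto simp: H_def)
  have "\<phi> \<in> ring_hom R G"
    using \<phi> \<phi>G by (auto simp: ring_hom_def G_def)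
  then have "e \<circ> \<phi> \<in> ring_hom R S'"
    using hom by (rule ring_hom_trans)
  then have \<psi>: "\<psi> \<in> Ring_hom R S'"
    unfolding \<psi>_def Ring_hom_def by (auto simp: ring_hom_def)
  have "\<one>\<^bsub>S'\<^esub> \<noteq> \<zero>\<^bsub>S'\<^esub>"
    using nz inj[OF G.one_closed G.zero_closed] zero one by (simp add: G_def)
  then have S': "S' \<in> Ring_obj"
    using S'.ring_axioms by (simp add: Ring_obj_def)
  have ker: "\<psi> x = \<zero>\<^bsub>S'\<^esub> \<longleftrightarrow> \<phi> x = \<zero>\<^bsub>S\<^esub>" if "x \<in> carrier R" for x
    using that inj[OF \<phi>G[OF that] G.zero_closed] zero by (simp add: \<psi>_def G_def)
  have unit: "\<psi> x \<in> Units S' \<longleftrightarrow> \<phi> x \<in> Units S" if x: "x \<in> carrier R" for x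
  proof
    assume "\<psi> x \<in> Units S'"
    then obtain y where y: "y \<in> carrier S'" "y \<otimes>\<^bsub>S'\<^esub> e (\<phi> x) = \<one>\<^bsub>S'\<^esub>" "e (\<phi> x) \<otimes>\<^bsub>S'\<^esub> y = \<one>\<^bsub>S'\<^esub>"
      using x by (auto simp: Units_def \<psi>_def)
    obtain z where z: "z \<in> carrier G" "y = e z"
      using y(1) bij by (auto simp: bij_betw_def)
    have "e (z \<otimes>\<^bsub>G\<^esub> \<phi> x) = e \<one>\<^bsub>G\<^esub>" "e (\<phi> x \<otimes>\<^bsub>G\<^esub> z) = e \<one>\<^bsub>G\<^esub>"
      using y(2,3) z \<phi>G[OF x] one ring_hom_mult[OF hom] by auto
    then have "z \<otimes>\<^bsub>G\<^esub> \<phi> x = \<one>\<^bsub>G\<^esub>" "\<phi> x \<otimes>\<^bsub>G\<^esub> z = \<one>\<^bsub>G\<^esub>"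
      using inj z(1) \<phi>G[OF x] by (metis G.m_closed G.one_closed)+
    moreover have "z \<in> carrier S"
      using z(1) S.generate_ring_in_carrier[OF H] by (simp add: G_def)
    moreover have "\<phi> x \<in> carrier S"
      using I x by blast
    ultimately show "\<phi> x \<in> Units S"
      by (auto simp: Units_def G_def)
  next
    assume u: "\<phi> x \<in> Units S"
    let ?z = "inv\<^bsub>S\<^esub> \<phi> x"
    have z: "?z \<in> carrier G"
      using u x by (intro HG) (auto simp: H_def)
    have "?z \<otimes>\<^bsub>G\<^esub> \<phi> x = \<one>\<^bsub>G\<^esub>" "\<phi> x \<otimes>\<^bsub>G\<^esub> ?z = \<one>\<^bsub>G\<^esub>"
      using u by (simp_all add: G_def)
    then have "e ?z \<otimes>\<^bsub>S'\<^esub> e (\<phi> x) = \<one>\<^bsub>S'\<^esub>" "e (\<phi> x) \<otimes>\<^bsub>S'\<^esub> e ?z = \<one>\<^bsub>S'\<^esub>"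
      using ring_hom_mult[OF hom] z \<phi>G[OF x] one by metis+
    moreover have "e ?z \<in> carrier S'" "e (\<phi> x) \<in> carrier S'"
      using ring_hom_closed[OF hom] z \<phi>G[OF x] by auto
    ultimately show "\<psi> x \<in> Units S'"
      using x by (auto simp: Units_def \<psi>_def)
  qed
  have "ker_units_pair R S \<phi> = ker_units_pair R S' \<psi>"
    using ker unit by (auto simp: ker_units_pair_def a_kernel_def')
  then show ?thesis
    using S' \<psi> unfolding Hom_obj_def by blast
qed

end

theory Submission
  imports Defs
begin

text \<open>
  A representable functor takes the initial ring \<open>\<int>\<close> to a singleton, because there is only one
  morphism from \<open>\<int>\<close> to any ring (\<open>int_ring_hom_unique\<close>). But \<open>Hom(\<int>)\<close> has several elements: the
  identity of \<open>\<int>\<close> and the reduction \<open>\<int> \<rightarrow> \<int>/2\<close> have different kernels. An infinite type contains a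
  copy of \<open>\<int>\<close>, so this comparison is available in every universe.
\<close>

lemma int_ring_hom_unique:
  assumes "ring A" and f: "f \<in> ring_hom \<Z> A" and g: "g \<in> ring_hom \<Z> A"
  shows "f n = g n"
proof -
  interpret f: ring_hom_ring \<Z> A f
    using f \<open>ring A\<close> int.ring_axioms by (simp add: ring_hom_ring_def ring_hom_ring_axioms_def)
  interpret g: ring_hom_ring \<Z> A g
    using g \<open>ring A\<close> int.ring_axioms by (simp add: ring_hom_ring_def ring_hom_ring_axioms_def)
  have f_add: "f (a + b) = f a \<oplus>\<^bsub>A\<^esub> f b" and g_add: "g (a + b) = g a \<oplus>\<^bsub>A\<^esub> g b" for a b
    using f.hom_add[of a b] g.hom_add[of a b] by simp_all
  have zero: "f 0 = g 0" and one: "f 1 = g 1"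
    using f.hom_zero g.hom_zero f.hom_one g.hom_one by simp_all
  have "f (- 1) = g (- 1)"
    using f.hom_a_inv[of 1] g.hom_a_inv[of 1] one by simp
  then have step: "f (i + 1) = g (i + 1)" "f (i - 1) = g (i - 1)" if "f i = g i" for i
    using that one f_add[of i 1] g_add[of i 1] f_add[of i "- 1"] g_add[of i "- 1"] by simp_all
  show ?thesis
    using zero step by (induction n rule: int_induct[where k = 0]) auto
qed

lemma ex_int_ring_copy:
  assumes "infinite (UNIV :: 'u set)"
  obtains R :: "'u ring" and e where "ring R" "e \<in> ring_iso \<Z> R"
proof -
  have "|UNIV :: nat set| \<le>o |UNIV :: 'u set|"
    using assms infinite_iff_card_of_nat by blast
  then obtain k :: "nat \<Rightarrow> 'u" where "inj k"
    using card_of_ordLeq[of "UNIV :: nat set" "UNIV :: 'u set"] by blast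
  then have inj: "inj_on (k \<circ> to_nat :: int \<Rightarrow> 'u) (carrier \<Z>)"
    by (simp add: inj_compose)
  show ?thesis
    using that ring.inj_imp_image_ring_is_ring[OF int.ring_axioms inj] inj_imp_image_ring_iso[OF inj] by blast
qed

theorem mainTheorem12:
  assumes "infinite (UNIV :: 'u set)"
  shows "\<not> representable (Hom_obj :: 'u ring \<Rightarrow> ('u set \<times> 'u set) set) Hom_map"
proof
  assume "representable (Hom_obj :: 'u ring \<Rightarrow> ('u set \<times> 'u set) set) Hom_map"
  then obtain A :: "'u ring" and \<eta> where A: "A \<in> Ring_obj"
    and bij: "\<And>R. R \<in> Ring_obj \<Longrightarrow> bij_betw (\<eta> R) (Hom_obj R) (Ring_hom R A)"
    unfolding representable_def naturally_isomorphic_def repr_obj_def by blast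
  obtain R :: "'u ring" and e where R: "ring R" and e: "e \<in> ring_iso \<Z> R"
    using ex_int_ring_copy[OF assms] by blast
  define d where "d = inv_into (carrier \<Z>) e"
  have e_hom: "e \<in> ring_hom \<Z> R" and e_bij: "bij_betw e (carrier \<Z>) (carrier R)"
    using e by (auto simp: ring_iso_def)
  have "d \<in> ring_iso R \<Z>"
    unfolding d_def by (rule ring_iso_set_sym[OF int.ring_axioms e])
  then have d_hom: "d \<in> ring_hom R \<Z>"
    by (simp add: ring_iso_def)
  have de: "d (e n) = n" for n
    using e_bij by (simp add: d_def bij_betw_def)
  have e_in: "e n \<in> carrier R" for n
    using ring_hom_closed[OF e_hom] by simp

  have "\<one>\<^bsub>R\<^esub> \<noteq> \<zero>\<^bsub>R\<^esub>"
    using de[of 0] de[of 1] ring_hom_one[OF e_hom]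
      ring_hom_zero[OF e_hom int.ring_axioms R] by auto
  then have R_obj: "R \<in> Ring_obj"
    using R by (simp add: Ring_obj_def)

  have hom_unique: "f = g" if f: "f \<in> Ring_hom R A" and g: "g \<in> Ring_hom R A" for f g
  proof (rule extensionalityI)
    show "f \<in> extensional (carrier R)" "g \<in> extensional (carrier R)"
      using f g by (auto simp: Ring_hom_def)
    fix x assume "x \<in> carrier R"
    then obtain n where x: "x = e n"
      using e_bij by (auto simp: bij_betw_def)
    have "f \<circ> e \<in> ring_hom \<Z> A" "g \<circ> e \<in> ring_hom \<Z> A"
      using f g ring_hom_trans[OF e_hom] by (auto simp: Ring_hom_def)
    then have "(f \<circ> e) n = (g \<circ> e) n"
      using A int_ring_hom_unique[of A "f \<circ> e" "g \<circ> e" n] by (simp add: Ring_obj_def)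
    then show "f x = g x"
      by (simp add: x)
  qed

  define I where "I = Idl\<^bsub>\<Z>\<^esub> {2 :: int}"
  interpret I: ideal I \<Z>
    unfolding I_def by (rule int.genideal_ideal) simp
  interpret F: domain "ZFact 2"
    by (rule ZFact_prime_is_domain) simp
  define q where "q = (+>\<^bsub>\<Z>\<^esub>) I"
  have q_hom: "q \<in> ring_hom \<Z> (ZFact 2)"
    using I.rcos_ring_hom by (simp add: q_def I_def ZFact_def)
  have "2 \<in> I"
    unfolding I_def by (rule int.genideal_self') simp
  then have q2: "q 2 = \<zero>\<^bsub>ZFact 2\<^esub>"
    using I.a_rcos_const by (simp add: q_def I_def ZFact_def FactRing_def)

  define p where "p = ker_units_pair R \<Z> d"
  define p' where "p' = ker_units_pair R (ZFact 2) (q \<circ> d)"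
  have p: "p \<in> Hom_obj R"
    unfolding p_def
    by (rule ker_units_pair_in_Hom_obj[OF assms int.ring_axioms _ d_hom R]) simp
  have p': "p' \<in> Hom_obj R"
    unfolding p'_def
    by (rule ker_units_pair_in_Hom_obj[OF assms F.ring_axioms _ ring_hom_trans[OF d_hom q_hom] R])
      simp
  have "e 2 \<in> fst p'" "e 2 \<notin> fst p"
    using e_in q2 by (simp_all add: p_def p'_def ker_units_pair_def a_kernel_def' de)
  then have "p \<noteq> p'"
    by blast
  moreover have "\<eta> R p = \<eta> R p'"
    using bij_betwE[OF bij[OF R_obj]] p p' hom_unique by blast
  ultimately show False
    using bij_betw_imp_inj_on[OF bij[OF R_obj]] p p' by (auto dest: inj_onD)
qed

end
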